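(* There exist constants $c>0$ and $\epsilon_0>0$ such that for every $\epsilon\in(0,\epsilon_0)$ the following holds, both for the online \textsc{SubsetSum} problem and for the online weighted \textsc{MaximumIndependentSet} problem (objects may arrive and depart, starting from the empty instance). There is an online instance such that every online algorithm which at every time maintains a solution of profit at least $(1-\epsilon)\,\mathrm{opt}$ has amortized migration factor at least $c/\epsilon$ on this instance.
   Context: Online model: an online instance is a sequence $I_0=\emptyset,I_1,\dots$ in which at each step one object arrives or one present object departs. The algorithm outputs a feasible solution $S_t\subseteq I_t$ at each time without knowledge of the future. \textsc{SubsetSum}: a fixed capacity $C$ and items with sizes $s_i$; a subset is feasible iff its total size is at most $C$, and its profit is its total size. Weighted \textsc{MaximumIndependentSet}: objects are weighted vertices arriving or departing together with their incident edges; feasible sets are independent sets, and the profit is the total weight. The migration potential of a step is the profit (size/weight) of the arriving or departing object. The migration cost of changing $S_{t-1}$ to $S_t$ is the profit of $S_{t-1}\triangle S_t$, where including a newly arrived object costs nothing. The amortized migration factor is the maximum over times $t$ of (total migration cost up to $t$)/(total migration potential up to $t$). *)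

theory Defs
  imports Complex_Main
begin

text \<open>The identifier lets distinct objects have equal size or weight.\<close>

datatype obj = Obj (ident: nat) (profit: real)

definition total :: "obj set \<Rightarrow> real" where
  "total S = (\<Sum>x\<in>S. profit x)"

text \<open>
  \<open>'i\<close> is the type of static instances \<open>I\<^sub>t\<close>.  \<open>solutions P I\<close> are the
  feasible subsets of \<open>objects P I\<close>, and \<open>arrival P I x I'\<close> says that \<open>I'\<close> may
  result from \<open>I\<close> by the arrival of \<open>x\<close>.  A departure is an arrival read backwards.
\<close>

record 'i problem =
  start :: 'i
  objects :: "'i \<Rightarrow> obj set"
  solutions :: "'i \<Rightarrow> obj set set"
  arrival :: "'i \<Rightarrow> obj \<Rightarrow> 'i \<Rightarrow> bool"

definition opt :: "'i problem \<Rightarrow> 'i \<Rightarrow> real" where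
  "opt P I = Max (total ` solutions P I)"

definition online_step :: "'i problem \<Rightarrow> 'i \<Rightarrow> 'i \<Rightarrow> bool" where
  "online_step P I I' \<longleftrightarrow>
     (\<exists>x. profit x > 0 \<and> (arrival P I x I' \<or> arrival P I' x I))"

text \<open>The list \<open>Is\<close> is \<open>[I\<^sub>0, \<dots>, I\<^sub>T]\<close>.\<close>

definition online_instance :: "'i problem \<Rightarrow> 'i list \<Rightarrow> bool" where
  "online_instance P Is \<longleftrightarrow>
     Is \<noteq> [] \<and> Is ! 0 = start P \<and>
     (\<forall>t. Suc t < length Is \<longrightarrow> online_step P (Is ! t) (Is ! Suc t))"

text \<open>An online algorithm maps the history \<open>[I\<^sub>0, \<dots>, I\<^sub>t]\<close> to its solution \<open>S\<^sub>t\<close>.\<close>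

type_synonym 'i online_alg = "'i list \<Rightarrow> obj set"

definition solution_at :: "'i online_alg \<Rightarrow> 'i list \<Rightarrow> nat \<Rightarrow> obj set" where
  "solution_at A Is t = A (take (Suc t) Is)"

definition maintains_approx ::
    "'i problem \<Rightarrow> real \<Rightarrow> 'i online_alg \<Rightarrow> 'i list \<Rightarrow> bool" where
  "maintains_approx P \<epsilon> A Is \<longleftrightarrow>
     (\<forall>t < length Is. solution_at A Is t \<in> solutions P (Is ! t) \<and>
        total (solution_at A Is t) \<ge> (1 - \<epsilon>) * opt P (Is ! t))"

text \<open>For the step from \<open>I\<close> to \<open>I'\<close>, the symmetric difference of the object sets
  consists of the arriving or departing object only.\<close>

definition migration_potential :: "'i problem \<Rightarrow> 'i \<Rightarrow> 'i \<Rightarrow> real" where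
  "migration_potential P I I' = total (sym_diff (objects P I) (objects P I'))"

text \<open>Only the inclusion of a newly arrived object is free; a departing object that
  was part of \<open>S\<close> is charged.\<close>

definition migration_cost :: "'i problem \<Rightarrow> 'i \<Rightarrow> 'i \<Rightarrow> obj set \<Rightarrow> obj set \<Rightarrow> real" where
  "migration_cost P I I' S S' = total (sym_diff S S' - (objects P I' - objects P I))"

definition total_potential :: "'i problem \<Rightarrow> 'i list \<Rightarrow> nat \<Rightarrow> real" where
  "total_potential P Is t = (\<Sum>k<t. migration_potential P (Is ! k) (Is ! Suc k))"

definition total_cost :: "'i problem \<Rightarrow> 'i online_alg \<Rightarrow> 'i list \<Rightarrow> nat \<Rightarrow> real" where
  "total_cost P A Is t =
     (\<Sum>k<t. migration_cost P (Is ! k) (Is ! Suc k) (solution_at A Is k) (solution_at A Is (Suc k)))"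

text \<open>The term for \<open>t = 0\<close> is \<open>0 / 0 = 0\<close>; as all other ratios are nonnegative it
  affects the maximum only in the trivial instance without steps.\<close>

definition amortized_migration_factor ::
    "'i problem \<Rightarrow> 'i online_alg \<Rightarrow> 'i list \<Rightarrow> real" where
  "amortized_migration_factor P A Is =
     Max ((\<lambda>t. total_cost P A Is t / total_potential P Is t) ` {..<length Is})"

definition subset_sum :: "real \<Rightarrow> obj set problem" where
  "subset_sum C = \<lparr>
     start = {},
     objects = (\<lambda>I. I),
     solutions = (\<lambda>I. {S. S \<subseteq> I \<and> total S \<le> C}),
     arrival = (\<lambda>I x I'. x \<notin> I \<and> I' = insert x I)\<rparr>"

record wgraph =
  verts :: "obj set"
  edges :: "obj set set"

definition simple_graph :: "wgraph \<Rightarrow> bool" where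
  "simple_graph G \<longleftrightarrow>
     (\<forall>e \<in> edges G. \<exists>u \<in> verts G. \<exists>v \<in> verts G. u \<noteq> v \<and> e = {u, v})"

definition independent_sets :: "wgraph \<Rightarrow> obj set set" where
  "independent_sets G = {S. S \<subseteq> verts G \<and> (\<forall>u \<in> S. \<forall>v \<in> S. {u, v} \<notin> edges G)}"

definition vertex_arrival :: "wgraph \<Rightarrow> obj \<Rightarrow> wgraph \<Rightarrow> bool" where
  "vertex_arrival G x G' \<longleftrightarrow>
     simple_graph G' \<and> x \<notin> verts G \<and> verts G' = insert x (verts G) \<and>
     edges G = {e \<in> edges G'. x \<notin> e}"

definition max_independent_set :: "wgraph problem" where
  "max_independent_set = \<lparr>
     start = \<lparr>verts = {}, edges = {}\<rparr>,
     objects = verts,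
     solutions = independent_sets,
     arrival = vertex_arrival\<rparr>"

end

(*  For capacity C take items a, b, s of sizes (1 - 4 eps) C, (1 - 2 eps) C and 4 eps C.
    Besides single items, {a, s} is the only feasible pair, and its size is C.  So {b} is the only
    good solution for {a, b}, and {a, s} is the only good solution for {a, b, s}.
    If s keeps arriving and departing, then every step moves a and b at a
    potential of only 4 eps C, and after about 1/eps steps the arrivals of a and b are paid off.
    The graph with the edges ab and bs and these weights has the same feasible sets.  *)

theory Submission
  imports Defs
begin

section \<open>Elementary bounds on totals, optimum and migration factor\<close>

lemma total_nonneg:
  assumes "\<And>x. x \<in> S \<Longrightarrow> 0 \<le> profit x"
  shows "0 \<le> total S"
  unfolding total_def by (rule sum_nonneg) (use assms in auto)

lemma profit_le_total:
  assumes "finite S" "x \<in> S" "\<And>y. y \<in> S \<Longrightarrow> 0 \<le> profit y"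
  shows "profit x \<le> total S"
  unfolding total_def by (rule member_le_sum) (use assms in auto)

lemma total_le_opt:
  assumes "finite (solutions P I)" "S \<in> solutions P I"
  shows "total S \<le> opt P I"
  unfolding opt_def by (rule Max_ge) (use assms in auto)

lemma amortized_migration_factor_ge:
  assumes "t < length Is"
  shows "total_cost P A Is t / total_potential P Is t \<le> amortized_migration_factor P A Is"
  unfolding amortized_migration_factor_def by (rule Max_ge) (use assms in auto)

text \<open>Both problems enter only through this interface: \<open>conflicts\<close> limits which
  sets are feasible, which bounds the alternatives from above, and \<open>good_solutions\<close>
  bounds \<open>opt\<close> from below.\<close>

locale oscillation =
  fixes P :: "'i problem" and C \<epsilon> :: real and a b s :: obj and I\<^sub>a I\<^sub>a\<^sub>b I\<^sub>a\<^sub>b\<^sub>s :: 'i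
  assumes C_pos: "0 < C" and eps_pos: "0 < \<epsilon>" and eps_less: "\<epsilon> < 1 / 8"
    and profits: "profit a = (1 - 4 * \<epsilon>) * C" "profit b = (1 - 2 * \<epsilon>) * C" "profit s = 4 * \<epsilon> * C"
    and distinct_objs: "a \<noteq> b" "a \<noteq> s" "b \<noteq> s"
    and objects: "objects P (start P) = {}" "objects P I\<^sub>a = {a}"
      "objects P I\<^sub>a\<^sub>b = {a, b}" "objects P I\<^sub>a\<^sub>b\<^sub>s = {a, b, s}"
    and arrivals: "arrival P (start P) a I\<^sub>a" "arrival P I\<^sub>a b I\<^sub>a\<^sub>b" "arrival P I\<^sub>a\<^sub>b s I\<^sub>a\<^sub>b\<^sub>s"
    and solutions_objects: "\<And>I. solutions P I \<subseteq> Pow (objects P I)"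
    and conflicts: "\<And>S. S \<in> solutions P I\<^sub>a\<^sub>b \<union> solutions P I\<^sub>a\<^sub>b\<^sub>s \<Longrightarrow> b \<in> S \<Longrightarrow> a \<notin> S \<and> s \<notin> S"
    and good_solutions: "{b} \<in> solutions P I\<^sub>a\<^sub>b" "{a, s} \<in> solutions P I\<^sub>a\<^sub>b\<^sub>s"
begin

definition state :: "nat \<Rightarrow> 'i" where
  "state t = (if t = 0 then start P else if t = 1 then I\<^sub>a else if even t then I\<^sub>a\<^sub>b else I\<^sub>a\<^sub>b\<^sub>s)"

text \<open>Two steps bring in \<open>a\<close> and \<open>b\<close>, then \<open>N\<close> steps
  toggle \<open>s\<close>; this makes \<open>N + 2\<close> steps and \<open>N + 3\<close>
  states.\<close>

definition run :: "nat \<Rightarrow> 'i list" where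
  "run N = map state [0..<N + 3]"

lemma length_run [simp]: "length (run N) = N + 3"
  by (simp add: run_def)

lemma nth_run [simp]: "t < N + 3 \<Longrightarrow> run N ! t = state t"
  unfolding run_def by (subst nth_map) auto

lemma objects_state: "objects P (state t) \<subseteq> {a, b, s}"
  by (auto simp: state_def objects split: if_splits)

lemma profit_pos: "0 < profit a" "0 < profit b" "0 < profit s"
  using C_pos eps_pos eps_less by (auto simp: profits intro!: mult_pos_pos)

lemma online_instance_run: "online_instance P (run N)"
proof -
  \<comment> \<open>For \<open>t \<ge> 2\<close>, \<open>s\<close> arrives if \<open>t\<close> is
    even and departs if \<open>t\<close> is odd; the departure is its arrival read
    backwards.\<close>
  have "online_step P (state t) (state (Suc t))" for t
    using arrivals profit_pos unfolding online_step_def state_def by (cases "t = 0") auto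
  moreover have "run N \<noteq> []"
    using length_run[of N] by fastforce
  ultimately show ?thesis
    by (auto simp: online_instance_def) (simp add: state_def)
qed

lemma finite_solutions: "finite (objects P I) \<Longrightarrow> finite (solutions P I)"
  by (rule finite_subset[OF solutions_objects]) simp

section \<open>Forced solutions\<close>

text \<open>The other feasible sets are empty or \<open>{a}\<close>, and
  \<open>1 - 4 * \<epsilon>\<close> falls short of
  \<open>(1 - \<epsilon>) * (1 - 2 * \<epsilon>)\<close> by
  \<open>\<epsilon> + 2 * \<epsilon> * \<epsilon>\<close>.\<close>

lemma approx_without_s:
  assumes S: "S \<in> solutions P I\<^sub>a\<^sub>b" and apx: "(1 - \<epsilon>) * opt P I\<^sub>a\<^sub>b \<le> total S"
  shows "S = {b}"
proof (rule ccontr)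
  assume "S \<noteq> {b}"
  moreover have "S \<subseteq> {a, b}"
    using S solutions_objects[of I\<^sub>a\<^sub>b] objects by auto
  ultimately have "S = {} \<or> S = {a}"
    using conflicts[of S] S by auto
  then have "total S \<le> profit a"
    using profit_pos by (auto simp: total_def)
  moreover have "profit b \<le> opt P I\<^sub>a\<^sub>b"
    using total_le_opt[OF finite_solutions good_solutions(1)] by (simp add: objects total_def)
  then have "(1 - \<epsilon>) * profit b \<le> (1 - \<epsilon>) * opt P I\<^sub>a\<^sub>b"
    using eps_less by (intro mult_left_mono) auto
  ultimately have "(1 - \<epsilon>) * ((1 - 2 * \<epsilon>) * C) \<le> (1 - 4 * \<epsilon>) * C"
    using apx by (simp add: profits)
  then have "(\<epsilon> + 2 * \<epsilon> * \<epsilon>) * C \<le> 0"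
    by (simp add: algebra_simps)
  moreover have "0 < (\<epsilon> + 2 * \<epsilon> * \<epsilon>) * C"
    using C_pos eps_pos by (intro mult_pos_pos add_pos_pos) auto
  ultimately show False
    by linarith
qed

text \<open>Every other feasible set has at most one object, hence total at most
  \<open>profit b\<close>, while \<open>{a, s}\<close> reaches \<open>C\<close>.\<close>

lemma approx_with_s:
  assumes S: "S \<in> solutions P I\<^sub>a\<^sub>b\<^sub>s" and apx: "(1 - \<epsilon>) * opt P I\<^sub>a\<^sub>b\<^sub>s \<le> total S"
  shows "S = {a, s}"
proof (rule ccontr)
  assume "S \<noteq> {a, s}"
  moreover have "S \<in> Pow {a, b, s}"
    using S solutions_objects[of I\<^sub>a\<^sub>b\<^sub>s] objects by auto
  moreover have "b \<in> S \<Longrightarrow> a \<notin> S \<and> s \<notin> S"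
    using conflicts[of S] S by simp
  ultimately have "S = {} \<or> S = {a} \<or> S = {b} \<or> S = {s}"
    unfolding Pow_insert by auto
  \<comment> \<open>The second inequality amounts to \<open>6 * \<epsilon> \<le> 1\<close>.\<close>
  moreover have "profit a \<le> profit b" "profit s \<le> profit b"
    using C_pos eps_pos eps_less by (auto simp: profits)
  ultimately have "total S \<le> profit b"
    using profit_pos by (auto simp: total_def)
  moreover have "C \<le> opt P I\<^sub>a\<^sub>b\<^sub>s"
    using total_le_opt[OF finite_solutions good_solutions(2)] distinct_objs
    by (simp add: objects total_def profits algebra_simps)
  then have "(1 - \<epsilon>) * C \<le> (1 - \<epsilon>) * opt P I\<^sub>a\<^sub>b\<^sub>s"
    using eps_less by (intro mult_left_mono) auto
  ultimately have "(1 - \<epsilon>) * C \<le> (1 - 2 * \<epsilon>) * C"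
    using apx by (simp add: profits)
  then show False
    using C_pos eps_pos by simp
qed

section \<open>Potential against cost\<close>

lemma total_potential_run:
  "total_potential P (run N) (N + 2) = (2 - 6 * \<epsilon>) * C + real N * (4 * \<epsilon> * C)"
proof -
  define pot where "pot k = migration_potential P (state k) (state (Suc k))" for k
  have "total_potential P (run N) (N + 2) = (\<Sum>k<Suc (Suc N). pot k)"
    unfolding total_potential_def pot_def by (intro sum.cong) auto
  also have "\<dots> = pot 0 + (pot 1 + (\<Sum>k<N. pot (Suc (Suc k))))"
    by (simp only: sum.lessThan_Suc_shift One_nat_def)
  also have "pot 0 = profit a"
    by (simp add: pot_def migration_potential_def state_def objects total_def)
  also have "sym_diff {a} {a, b} = {b}"
    using distinct_objs by auto
  then have "pot 1 = profit b"
    by (simp add: pot_def migration_potential_def state_def objects total_def)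
  \<comment> \<open>Arrival and departure of \<open>s\<close> have the same potential, so the parity
    of \<open>k\<close> is irrelevant.\<close>
  also have "sym_diff {a, b} {a, b, s} = {s}" "sym_diff {a, b, s} {a, b} = {s}"
    using distinct_objs by auto
  then have "pot (Suc (Suc k)) = profit s" for k
    by (auto simp: pot_def migration_potential_def state_def objects total_def)
  then have "(\<Sum>k<N. pot (Suc (Suc k))) = real N * profit s"
    by simp
  finally show ?thesis
    by (simp add: profits algebra_simps)
qed

text \<open>From time 2 on the solutions are forced to alternate, so each of the \<open>N\<close>
  toggles moves \<open>a\<close>. Counting \<open>a\<close> alone suffices for the bound.\<close>

lemma total_cost_run:
  assumes apx: "maintains_approx P \<epsilon> A (run N)"
  shows "real N * ((1 - 4 * \<epsilon>) * C) \<le> total_cost P A (run N) (N + 2)"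
proof -
  define S where "S = solution_at A (run N)"
  define cost where "cost k = migration_cost P (state k) (state (Suc k)) (S k) (S (Suc k))" for k
  define moved where
    "moved k = sym_diff (S k) (S (Suc k)) - (objects P (state (Suc k)) - objects P (state k))" for k
  have sol: "S t \<in> solutions P (state t)"
    and good: "(1 - \<epsilon>) * opt P (state t) \<le> total (S t)" if "t < N + 3" for t
    using apx that by (auto simp: maintains_approx_def S_def)
  have S_sub: "S t \<subseteq> {a, b, s}" if "t < N + 3" for t
    using sol[OF that] solutions_objects objects_state by blast
  have moved: "moved k \<subseteq> {a, b, s}" if "k < N + 2" for k
    using S_sub[of k] S_sub[of "Suc k"] that unfolding moved_def by auto
  then have nonneg: "0 \<le> profit x" if "x \<in> moved k" "k < N + 2" for x k
    using that profit_pos by fastforce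
  have cost_nonneg: "0 \<le> cost k" if "k < N + 2" for k
    unfolding cost_def migration_cost_def moved_def[symmetric]
    by (rule total_nonneg) (use nonneg that in blast)
  have Seq: "S t = (if even t then {b} else {a, s})" if "2 \<le> t" "t < N + 3" for t
    using sol[OF that(2)] good[OF that(2)] approx_without_s[of "S t"] approx_with_s[of "S t"] that(1)
    by (simp add: state_def split: if_splits)
  have cost_ge: "profit a \<le> cost (Suc (Suc k))" if "k < N" for k
  proof -
    \<comment> \<open>Since \<open>a\<close> is present before the step, including it is not
      free.\<close>
    have "a \<in> objects P (state (Suc (Suc k)))"
      by (simp add: state_def objects)
    moreover have "a \<in> sym_diff (S (Suc (Suc k))) (S (Suc (Suc (Suc k))))"
      using Seq[of "Suc (Suc k)"] Seq[of "Suc (Suc (Suc k))"] that distinct_objs by auto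
    ultimately have "a \<in> moved (Suc (Suc k))"
      by (simp add: moved_def)
    moreover have "finite (moved (Suc (Suc k)))"
      using moved[of "Suc (Suc k)"] that by (auto intro: finite_subset)
    ultimately show ?thesis
      unfolding cost_def migration_cost_def moved_def[symmetric]
      by (intro profit_le_total) (use nonneg that in auto)
  qed
  have "real N * profit a = (\<Sum>k<N. profit a)"
    by simp
  also have "\<dots> \<le> (\<Sum>k<N. cost (Suc (Suc k)))"
    by (rule sum_mono) (use cost_ge in auto)
  \<comment> \<open>Of the first two steps only nonnegativity of the cost is used.\<close>
  also have "\<dots> \<le> cost 0 + (cost 1 + (\<Sum>k<N. cost (Suc (Suc k))))"
    using cost_nonneg[of 0] cost_nonneg[of 1] by simp
  also have "\<dots> = (\<Sum>k<Suc (Suc N). cost k)"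
    by (simp only: sum.lessThan_Suc_shift One_nat_def)
  also have "\<dots> = total_cost P A (run N) (N + 2)"
    unfolding total_cost_def cost_def S_def by (intro sum.cong) auto
  finally show ?thesis
    by (simp add: profits)
qed

text \<open>With \<open>N\<close> at least \<open>1 / \<epsilon>\<close>, the potential is at most
  \<open>6 * \<epsilon> * N * C\<close> and the cost at least \<open>N * C / 2\<close>; their ratio
  gives the constant 1/12.\<close>

lemma amortized_migration_factor_run:
  assumes apx: "maintains_approx P \<epsilon> A (run N)" and N: "1 \<le> \<epsilon> * real N"
  shows "(1 / 12) / \<epsilon> \<le> amortized_migration_factor P A (run N)"
proof -
  let ?pot = "total_potential P (run N) (N + 2)" and ?cost = "total_cost P A (run N) (N + 2)"
  have pot_pos: "0 < ?pot"
    unfolding total_potential_run using C_pos eps_pos eps_less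
    by (intro add_pos_nonneg mult_pos_pos mult_nonneg_nonneg) auto
  \<comment> \<open>The initial arrivals are absorbed into the toggles, whose coefficient grows from
    4 to 6.\<close>
  have "(2 - 6 * \<epsilon>) * C \<le> (2 * (\<epsilon> * real N)) * C"
    using C_pos eps_pos N by (intro mult_right_mono) auto
  then have "?pot \<le> 6 * \<epsilon> * (real N * C)"
    unfolding total_potential_run by (simp add: algebra_simps)
  then have "(1 / 12) / \<epsilon> * ?pot \<le> (1 / 12) / \<epsilon> * (6 * \<epsilon> * (real N * C))"
    using eps_pos by (intro mult_left_mono) auto
  also have "\<dots> = real N * (1 / 2 * C)"
    using eps_pos by simp
  \<comment> \<open>This is where the threshold 1/8 comes from: it gives
    \<open>1 - 4 * \<epsilon> \<ge> 1 / 2\<close>.\<close>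
  also have "\<dots> \<le> real N * ((1 - 4 * \<epsilon>) * C)"
    using C_pos eps_less by (intro mult_left_mono mult_right_mono) auto
  also have "\<dots> \<le> ?cost"
    by (rule total_cost_run[OF apx])
  finally have "(1 / 12) / \<epsilon> \<le> ?cost / ?pot"
    using pot_pos by (simp only: pos_le_divide_eq)
  also have "\<dots> \<le> amortized_migration_factor P A (run N)"
    by (rule amortized_migration_factor_ge) simp
  finally show ?thesis .
qed

lemma hard_instance:
  "\<exists>Is. online_instance P Is \<and>
     (\<forall>A. maintains_approx P \<epsilon> A Is \<longrightarrow> (1 / 12) / \<epsilon> \<le> amortized_migration_factor P A Is)"
proof -
  \<comment> \<open>The choice of \<open>N\<close> depends on \<open>\<epsilon>\<close> only, so one
    instance defeats all algorithms.\<close>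
  obtain N where "1 / \<epsilon> \<le> real N"
    using real_arch_simple by blast
  then have "1 \<le> \<epsilon> * real N"
    using eps_pos by (simp add: field_simps)
  then show ?thesis
    using online_instance_run amortized_migration_factor_run by blast
qed

end

section \<open>The two concrete problems\<close>

text \<open>The capacity is met exactly by \<open>a\<close> and \<open>s\<close>, whereas
  \<open>b\<close> exceeds it with \<open>a\<close> (by \<open>(1 - 6 * \<epsilon>) * C\<close>) and
  with \<open>s\<close> (by \<open>2 * \<epsilon> * C\<close>).\<close>

lemma oscillation_subset_sum:
  assumes C: "0 < C" and \<epsilon>: "0 < \<epsilon>" "\<epsilon> < 1 / 8"
    and a: "a = Obj 0 ((1 - 4 * \<epsilon>) * C)" and b: "b = Obj 1 ((1 - 2 * \<epsilon>) * C)"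
    and s: "s = Obj 2 (4 * \<epsilon> * C)"
  shows "oscillation (subset_sum C) C \<epsilon> a b s {a} {a, b} {a, b, s}"
proof
  have pos: "0 < profit a" "0 < profit b" "0 < profit s"
    using C \<epsilon> by (auto simp: a b s intro!: mult_pos_pos)
  have ba: "C < profit b + profit a"
  proof -
    have "0 < (1 - 6 * \<epsilon>) * C"
      using C \<epsilon> by (intro mult_pos_pos) auto
    then show ?thesis
      by (simp add: a b algebra_simps)
  qed
  have bs: "C < profit b + profit s"
    using C \<epsilon> by (simp add: b s algebra_simps)
  fix S
  assume "S \<in> solutions (subset_sum C) {a, b} \<union> solutions (subset_sum C) {a, b, s}" and bS: "b \<in> S"
  then have sub: "S \<subseteq> {a, b, s}" and le: "total S \<le> C"
    by (auto simp: subset_sum_def)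
  \<comment> \<open>Sizes are positive, so a set containing \<open>b\<close> and \<open>x\<close> is
    at least as large as the pair.\<close>
  have "x \<notin> S" if "x \<noteq> b" "C < profit b + profit x" for x
  proof
    assume "x \<in> S"
    then have "(\<Sum>y\<in>{b, x}. profit y) \<le> total S"
      unfolding total_def using bS sub pos by (intro sum_mono2) (auto intro: finite_subset)
    then show False
      using that le by simp
  qed
  moreover have "a \<noteq> b" "s \<noteq> b"
    by (auto simp: a b s)
  ultimately show "a \<notin> S \<and> s \<notin> S"
    using ba bs by auto
next
  show "{b} \<in> solutions (subset_sum C) {a, b}" "{a, s} \<in> solutions (subset_sum C) {a, b, s}"
    using C \<epsilon> by (auto simp: subset_sum_def total_def a b s algebra_simps)
qed (use C \<epsilon> in \<open>auto simp: subset_sum_def a b s\<close>)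

text \<open>Adjacency replaces the capacity: \<open>b\<close> is the middle of a path whose ends
  \<open>a\<close> and \<open>s\<close> are independent and weigh 1 together, hence the scale
  1.\<close>

lemma oscillation_max_independent_set:
  assumes \<epsilon>: "0 < \<epsilon>" "\<epsilon> < 1 / 8"
    and a: "a = Obj 0 (1 - 4 * \<epsilon>)" and b: "b = Obj 1 (1 - 2 * \<epsilon>)" and s: "s = Obj 2 (4 * \<epsilon>)"
  shows "oscillation max_independent_set 1 \<epsilon> a b s
    \<lparr>verts = {a}, edges = {}\<rparr> \<lparr>verts = {a, b}, edges = {{a, b}}\<rparr>
    \<lparr>verts = {a, b, s}, edges = {{a, b}, {b, s}}\<rparr>"
proof -
  have distinct: "a \<noteq> b" "a \<noteq> s" "b \<noteq> s"
    by (auto simp: a b s)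
  have profits: "profit a = (1 - 4 * \<epsilon>) * 1" "profit b = (1 - 2 * \<epsilon>) * 1" "profit s = 4 * \<epsilon> * 1"
    by (auto simp: a b s)
  \<comment> \<open>\<open>vertex_arrival\<close> demands that removing \<open>s\<close> from the
    path leave exactly the earlier edge.\<close>
  have edges: "{e \<in> {{a, b}, {b, s}}. s \<notin> e} = {{a, b}}"
    using distinct by auto
  show ?thesis
    by unfold_locales
      (use \<epsilon> distinct profits edges in
        \<open>auto simp: max_independent_set_def vertex_arrival_def simple_graph_def
          independent_sets_def doubleton_eq_iff\<close>)
qed

theorem theorem4:
  "\<exists>c \<epsilon>\<^sub>0 :: real. c > 0 \<and> \<epsilon>\<^sub>0 > 0 \<and>
     (\<forall>\<epsilon>. 0 < \<epsilon> \<and> \<epsilon> < \<epsilon>\<^sub>0 \<longrightarrow>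
        (\<forall>C > 0. \<exists>Is. online_instance (subset_sum C) Is \<and>
           (\<forall>A. maintains_approx (subset_sum C) \<epsilon> A Is \<longrightarrow>
              amortized_migration_factor (subset_sum C) A Is \<ge> c / \<epsilon>)) \<and>
        (\<exists>Is. online_instance max_independent_set Is \<and>
           (\<forall>A. maintains_approx max_independent_set \<epsilon> A Is \<longrightarrow>
              amortized_migration_factor max_independent_set A Is \<ge> c / \<epsilon>)))"
proof (rule exI[of _ "1 / 12"], rule exI[of _ "1 / 8"], intro conjI allI impI)
  fix \<epsilon> C :: real
  assume "0 < \<epsilon> \<and> \<epsilon> < 1 / 8" "0 < C"
  then show "\<exists>Is. online_instance (subset_sum C) Is \<and>
      (\<forall>A. maintains_approx (subset_sum C) \<epsilon> A Is \<longrightarrow>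
         amortized_migration_factor (subset_sum C) A Is \<ge> (1 / 12) / \<epsilon>)"
    by (intro oscillation.hard_instance[OF oscillation_subset_sum[OF _ _ _ refl refl refl]]) auto
next
  fix \<epsilon> :: real
  assume "0 < \<epsilon> \<and> \<epsilon> < 1 / 8"
  then show "\<exists>Is. online_instance max_independent_set Is \<and>
      (\<forall>A. maintains_approx max_independent_set \<epsilon> A Is \<longrightarrow>
         amortized_migration_factor max_independent_set A Is \<ge> (1 / 12) / \<epsilon>)"
    by (intro oscillation.hard_instance[OF oscillation_max_independent_set[OF _ _ refl refl refl]]) auto
qed simp_all

end
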